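(* Let $H$ be a connected $r$-regular $u$-uniform hypergraph of girth $g$ with exactly $d+1$ distinct eigenvalues. If $g\ge 2d-1\ge 3$, then the point graph $\Gamma_H$ is a distance-regular graph of diameter $d$.
   Context: A hypergraph $H=(V,E)$ consists of a finite vertex set $V$ and a set $E$ of subsets of $V$ (edges), each of size at least 2 (no repeated edges). It is $u$-uniform ($u\ge 2$) if every edge has exactly $u$ vertices and $r$-regular ($r\ge 1$) if every vertex is in exactly $r$ edges. A walk of length $p$ from $x_0$ to $x_p$ is a sequence $(x_0,e_1,x_1,\ldots,e_p,x_p)$ of vertices $x_i$ and edges $e_i$ with $x_{i-1},x_i\in e_i$ and $x_{i-1}\ne x_i$ for $1\le i\le p$; $H$ is connected if any two vertices are joined by a walk. A Berge cycle is a walk with $x_0=x_p$ all of whose edges are distinct and all of whose vertices are distinct except for $x_0=x_p$; the girth of $H$ is the minimum length of a Berge cycle (so two distinct edges sharing two vertices give girth 2). The adjacency matrix $A$ is indexed by $V$ with $A_{xy}=|\{e\in E:\{x,y\}\subset e\}|$ for $x\ne y$ and $A_{xx}=0$; the eigenvalues of $H$ are those of $A$. The point graph $\Gamma_H$ is the multigraph on $V$ with $A_{xy}$ edges between $x$ and $y$; it is a simple graph when the girth is at least 3. A connected simple graph is distance-regular if, for all non-negative integers $i,j,l$, the number of vertices $z$ with $d(x,z)=i$ and $d(z,y)=j$ is the same for all pairs $(x,y)$ with $d(x,y)=l$. *)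

theory Defs
  imports
    "Graph_Theory.Graph_Theory"
    "Jordan_Normal_Form.Spectral_Radius"
    "HOL-Library.Extended_Nat"
begin

section \<open>Hypergraphs\<close>

definition hypergraph :: "'a set \<Rightarrow> 'a set set \<Rightarrow> bool" where
  "hypergraph V E \<longleftrightarrow> finite V \<and> (\<forall>e\<in>E. e \<subseteq> V \<and> 2 \<le> card e)"

definition hyper_uniform :: "'a set set \<Rightarrow> nat \<Rightarrow> bool" where
  "hyper_uniform E u \<longleftrightarrow> 2 \<le> u \<and> (\<forall>e\<in>E. card e = u)"

definition hyper_regular :: "'a set \<Rightarrow> 'a set set \<Rightarrow> nat \<Rightarrow> bool" where
  "hyper_regular V E r \<longleftrightarrow> 1 \<le> r \<and> (\<forall>x\<in>V. card {e \<in> E. x \<in> e} = r)"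

text \<open>The walk \<open>(x\<^sub>0, e\<^sub>1, x\<^sub>1, \<dots>, e\<^sub>p, x\<^sub>p)\<close> is split into the list
  \<open>xs = [x\<^sub>0, \<dots>, x\<^sub>p]\<close> and the list \<open>es = [e\<^sub>1, \<dots>, e\<^sub>p]\<close>, so that \<open>es ! i\<close>
  joins \<open>xs ! i\<close> to \<open>xs ! Suc i\<close>. The length of the walk is \<open>length es\<close>.\<close>

definition hyper_walk :: "'a set \<Rightarrow> 'a set set \<Rightarrow> 'a list \<Rightarrow> 'a set list \<Rightarrow> bool" where
  "hyper_walk V E xs es \<longleftrightarrow>
     length xs = Suc (length es) \<and> set xs \<subseteq> V \<and> set es \<subseteq> E \<and>
     (\<forall>i < length es. xs ! i \<in> es ! i \<and> xs ! Suc i \<in> es ! i \<and> xs ! i \<noteq> xs ! Suc i)"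

definition hyper_connected :: "'a set \<Rightarrow> 'a set set \<Rightarrow> bool" where
  "hyper_connected V E \<longleftrightarrow>
     (\<forall>x\<in>V. \<forall>y\<in>V. \<exists>xs es. hyper_walk V E xs es \<and> hd xs = x \<and> last xs = y)"

text \<open>The walk of length 0 is not a cycle. Length 1 is excluded by
  \<open>x\<^sub>0 \<noteq> x\<^sub>1\<close>, so the shortest possible Berge cycles have length 2.\<close>

definition berge_cycle :: "'a set \<Rightarrow> 'a set set \<Rightarrow> 'a list \<Rightarrow> 'a set list \<Rightarrow> bool" where
  "berge_cycle V E xs es \<longleftrightarrow>
     hyper_walk V E xs es \<and> es \<noteq> [] \<and> hd xs = last xs \<and> distinct es \<and> distinct (butlast xs)"

text \<open>The girth is \<open>\<infinity>\<close> when there is no Berge cycle.\<close>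

definition hyper_girth :: "'a set \<Rightarrow> 'a set set \<Rightarrow> enat" where
  "hyper_girth V E = (INF (xs, es) \<in> {(xs, es). berge_cycle V E xs es}. enat (length es))"


section \<open>Eigenvalues\<close>

definition hyper_adj :: "'a set set \<Rightarrow> 'a \<Rightarrow> 'a \<Rightarrow> nat" where
  "hyper_adj E x y = (if x = y then 0 else card {e \<in> E. {x, y} \<subseteq> e})"

text \<open>Matrices in the library are indexed by \<open>{0..<n}\<close>, so the vertices are enumerated by
  a list. The choice of the list is irrelevant, see \<open>hyper_eigenvalues_eq_spectrum\<close>.\<close>

definition hyper_adj_mat :: "'a list \<Rightarrow> 'a set set \<Rightarrow> complex mat" where
  "hyper_adj_mat vs E =
     mat (length vs) (length vs) (\<lambda>(i, j). of_nat (hyper_adj E (vs ! i) (vs ! j)))"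

definition hyper_eigenvalues :: "'a set \<Rightarrow> 'a set set \<Rightarrow> complex set" where
  "hyper_eigenvalues V E =
     (\<Union>vs \<in> {vs. distinct vs \<and> set vs = V}. spectrum (hyper_adj_mat vs E))"

lemma eigenvalue_hyper_adj_mat_iff:
  assumes "distinct vs" "set vs = V"
  shows "eigenvalue (hyper_adj_mat vs E) \<theta> \<longleftrightarrow>
    (\<exists>f. (\<exists>x\<in>V. f x \<noteq> 0) \<and> (\<forall>x\<in>V. (\<Sum>y\<in>V. of_nat (hyper_adj E x y) * f y) = \<theta> * f x))"
    (is "?L \<longleftrightarrow> ?R")
proof -
  let ?n = "length vs"
  let ?A = "hyper_adj_mat vs E"
  have dim: "dim_row ?A = ?n" "dim_col ?A = ?n"
    by (simp_all add: hyper_adj_mat_def)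
  have bij: "bij_betw ((!) vs) {0..<?n} V"
    using assms by (simp add: bij_betw_nth atLeast0LessThan)
  have mult: "(?A *\<^sub>v vec ?n (\<lambda>i. f (vs ! i))) $ i =
      (\<Sum>y\<in>V. of_nat (hyper_adj E (vs ! i) y) * f y)" if "i < ?n" for f i
    using that by (simp add: hyper_adj_mat_def scalar_prod_def
        sum.reindex_bij_betw[OF bij, symmetric])
  have ev: "eigenvector ?A (vec ?n (\<lambda>i. f (vs ! i))) \<theta> \<longleftrightarrow>
    (\<exists>x\<in>V. f x \<noteq> 0) \<and> (\<forall>x\<in>V. (\<Sum>y\<in>V. of_nat (hyper_adj E x y) * f y) = \<theta> * f x)" for f
  proof -
    have "vec ?n (\<lambda>i. f (vs ! i)) \<noteq> 0\<^sub>v ?n \<longleftrightarrow> (\<exists>x\<in>V. f x \<noteq> 0)"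
      using assms by (auto simp: vec_eq_iff set_conv_nth)
    moreover have "?A *\<^sub>v vec ?n (\<lambda>i. f (vs ! i)) = \<theta> \<cdot>\<^sub>v vec ?n (\<lambda>i. f (vs ! i)) \<longleftrightarrow>
        (\<forall>x\<in>V. (\<Sum>y\<in>V. of_nat (hyper_adj E x y) * f y) = \<theta> * f x)"
    proof -
      have "?A *\<^sub>v vec ?n (\<lambda>i. f (vs ! i)) = \<theta> \<cdot>\<^sub>v vec ?n (\<lambda>i. f (vs ! i)) \<longleftrightarrow>
        (\<forall>i<?n. (?A *\<^sub>v vec ?n (\<lambda>i. f (vs ! i))) $ i = \<theta> * f (vs ! i))"
        by (subst vec_eq_iff) (auto simp: dim)
      also have "\<dots> \<longleftrightarrow>
        (\<forall>i<?n. (\<Sum>y\<in>V. of_nat (hyper_adj E (vs ! i) y) * f y) = \<theta> * f (vs ! i))"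
        using mult by auto
      also have "\<dots> \<longleftrightarrow> (\<forall>x\<in>V. (\<Sum>y\<in>V. of_nat (hyper_adj E x y) * f y) = \<theta> * f x)"
        unfolding assms(2)[symmetric] all_set_conv_all_nth ..
      finally show ?thesis .
    qed
    moreover have "vec ?n (\<lambda>i. f (vs ! i)) \<in> carrier_vec ?n"
      by (rule vec_carrier)
    ultimately show ?thesis
      unfolding eigenvector_def dim by blast
  qed
  show ?thesis
  proof
    assume ?L
    then obtain v where v: "eigenvector ?A v \<theta>"
      unfolding eigenvalue_def by blast
    then have "dim_vec v = ?n"
      unfolding eigenvector_def dim by (blast dest: carrier_vecD)
    then have "v = vec ?n (\<lambda>i. v $ the_inv_into {0..<?n} ((!) vs) (vs ! i))"
      using bij_betw_imp_inj_on[OF bij] by (intro eq_vecI) (simp_all add: the_inv_into_f_f)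
    then have "eigenvector ?A (vec ?n (\<lambda>i. v $ the_inv_into {0..<?n} ((!) vs) (vs ! i))) \<theta>"
      using v by metis
    from this[unfolded ev[of "\<lambda>x. v $ the_inv_into {0..<?n} ((!) vs) x"]] show ?R
      by (rule exI[of _ "\<lambda>x. v $ the_inv_into {0..<?n} ((!) vs) x"])
  next
    assume ?R
    then show ?L
      unfolding eigenvalue_def ev[symmetric] by blast
  qed
qed

lemma hyper_eigenvalues_eq_spectrum:
  assumes "distinct vs" "set vs = V"
  shows "hyper_eigenvalues V E = spectrum (hyper_adj_mat vs E)"
  using assms unfolding hyper_eigenvalues_def spectrum_def
  by (auto simp: eigenvalue_hyper_adj_mat_iff)


section \<open>The point graph\<close>

text \<open>Following the conventions of the graph library, an undirected multigraph is a symmetric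
  digraph. The edge between \<open>x\<close> and \<open>y\<close> contributed by the hyperedge \<open>e\<close> is the pair of
  opposite arcs \<open>(x, e, y)\<close> and \<open>(y, e, x)\<close>.\<close>

definition point_graph :: "'a set \<Rightarrow> 'a set set \<Rightarrow> ('a, 'a \<times> 'a set \<times> 'a) pre_digraph" where
  "point_graph V E =
     \<lparr> verts = V,
       arcs = {(x, e, y). e \<in> E \<and> x \<in> e \<and> y \<in> e \<and> x \<noteq> y},
       tail = (\<lambda>(x, e, y). x),
       head = (\<lambda>(x, e, y). y) \<rparr>"

lemma card_arcs_point_graph:
  "card {a \<in> arcs (point_graph V E). tail (point_graph V E) a = x \<and> head (point_graph V E) a = y}
     = hyper_adj E x y"
proof (cases "x = y")
  case False
  have "{a \<in> arcs (point_graph V E). tail (point_graph V E) a = x \<and> head (point_graph V E) a = y}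
      = (\<lambda>e. (x, e, y)) ` {e \<in> E. {x, y} \<subseteq> e}"
    using False by (auto simp: point_graph_def)
  then show ?thesis
    using False by (simp add: hyper_adj_def card_image inj_on_def)
next
  case True
  have "{a \<in> arcs (point_graph V E). tail (point_graph V E) a = x \<and> head (point_graph V E) a = y} = {}"
    using True by (auto simp: point_graph_def)
  then show ?thesis
    unfolding hyper_adj_def using True by (simp only: card.empty if_True simp_thms)
qed

lemma pseudo_graph_point_graph:
  assumes "hypergraph V E"
  shows "pseudo_graph (point_graph V E)"
proof -
  let ?G = "point_graph V E"
  have V: "finite V" and E: "E \<subseteq> Pow V"
    using assms by (auto simp: hypergraph_def)
  then have "finite E"
    by (meson finite_Pow_iff finite_subset)
  moreover have "arcs ?G \<subseteq> V \<times> E \<times> V"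
    using E by (auto simp: point_graph_def)
  ultimately have "finite (arcs ?G)"
    using V by (meson finite_SigmaI finite_subset)
  moreover have "symmetric ?G"
    by (fastforce simp: symmetric_conv point_graph_def)
  ultimately show ?thesis
    using V E by unfold_locales (auto simp: point_graph_def)
qed


section \<open>Distance-regular graphs\<close>

text \<open>Distances are the library's shortest path lengths for the constant arc weight 1.\<close>

definition graph_dist :: "('a, 'b) pre_digraph \<Rightarrow> 'a \<Rightarrow> 'a \<Rightarrow> ereal" where
  "graph_dist G x y = wf_digraph.\<mu> G (\<lambda>_. 1) x y"

definition graph_diameter :: "('a, 'b) pre_digraph \<Rightarrow> ereal" where
  "graph_diameter G = (SUP x \<in> verts G. SUP y \<in> verts G. graph_dist G x y)"

text \<open>The locale \<^locale>\<open>graph\<close> stands for finite simple graphs: symmetric, without loops and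
  without parallel arcs.\<close>

definition distance_regular :: "('a, 'b) pre_digraph \<Rightarrow> bool" where
  "distance_regular G \<longleftrightarrow>
     graph G \<and> Digraph_Component.connected G \<and>
     (\<forall>i j l :: nat. \<exists>c :: nat. \<forall>x \<in> verts G. \<forall>y \<in> verts G. graph_dist G x y = ereal l \<longrightarrow>
        card {z \<in> verts G. graph_dist G x z = ereal i \<and> graph_dist G z y = ereal j} = c)"

end

theory Submission
  imports Defs "HOL-Computational_Algebra.Fundamental_Theorem_Algebra"
begin

text \<open>Non-backtracking walks with common ends are unique as long as their total length is below the
  girth. Hence for \<open>n < d\<close> the distance-\<open>n\<close> matrix \<open>A\<^sub>n\<close> of the point graph is a polynomial of
  degree \<open>n\<close> in the adjacency matrix \<open>A\<close>, by a three-term recurrence whose coefficients depend only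
  on \<open>r\<close> and \<open>u\<close>. As \<open>A\<close> is symmetric, its minimal polynomial has degree \<open>d + 1\<close>, so the all-ones
  matrix is a polynomial of degree \<open>d\<close> in \<open>A\<close> and of no smaller degree. The diameter is therefore
  \<open>d\<close>, and \<open>A\<^sub>d\<close>, which is the all-ones matrix minus the other \<open>A\<^sub>n\<close>, is a polynomial in \<open>A\<close> too.
  By degrees, every polynomial in \<open>A\<close> is a linear combination of \<open>A\<^sub>0, \<dots>, A\<^sub>d\<close>; applied to the
  products \<open>A\<^sub>i A\<^sub>j\<close> this is distance-regularity.\<close>

hide_const (open) module.smult

text \<open>Split off a root given by the fundamental theorem of algebra. The cofactor does not
  vanish there, so every step of the induction adds one new root.\<close>

lemma card_roots_eq_degree:
  fixes p :: "complex poly"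
  assumes "p \<noteq> 0" and "\<And>a. \<not> [:-a, 1:] * [:-a, 1:] dvd p"
  shows "card {z. poly p z = 0} = degree p"
  using assms
proof (induction "degree p" arbitrary: p)
  case 0
  then obtain c where "p = [:c:]" by (metis degree_eq_zeroE)
  then show ?case using 0 by auto
next
  case (Suc n)
  then obtain a where "poly p a = 0"
    using fundamental_theorem_of_algebra constant_degree by (metis nat.distinct(1))
  then obtain q where p: "p = [:-a, 1:] * q"
    unfolding poly_eq_0_iff_dvd by (rule dvdE)
  have q0: "q \<noteq> 0" using p Suc.prems by auto
  have deg: "degree p = Suc (degree q)"
    unfolding p using q0 by (subst degree_mult_eq) auto
  have "\<not> [:-b, 1:] * [:-b, 1:] dvd q" for b
    using Suc.prems(2)[of b] unfolding p by (metis dvd_mult)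
  then have "card {z. poly q z = 0} = degree q"
    using Suc.hyps q0 deg by auto
  moreover have "poly q a \<noteq> 0"
    using Suc.prems(2)[of a] unfolding p by (metis mult_dvd_mono dvd_refl poly_eq_0_iff_dvd)
  moreover have "{z. poly p z = 0} = insert a {z. poly q z = 0}"
    unfolding p by auto
  ultimately show ?case
    using poly_roots_finite[OF q0] deg by simp
qed

subsection \<open>Polynomials in a real symmetric kernel\<close>

locale sym_kernel =
  fixes V :: "'a set" and A :: "'a \<Rightarrow> 'a \<Rightarrow> complex"
  assumes finite_V: "finite V"
    and sym: "A x y = A y x"
    and real: "cnj (A x y) = A x y"
begin

definition app :: "('a \<Rightarrow> complex) \<Rightarrow> 'a \<Rightarrow> complex" where
  "app f x = (\<Sum>y\<in>V. A x y * f y)"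

text \<open>Horner evaluation of p(A) f. In particular \<open>papp p (delta x) y\<close> is the (y,
  x) entry of the matrix p(A), which is how all matrices below are expressed.\<close>

definition papp :: "complex poly \<Rightarrow> ('a \<Rightarrow> complex) \<Rightarrow> 'a \<Rightarrow> complex" where
  "papp p f = fold_coeffs (\<lambda>a g x. a * f x + app g x) p (\<lambda>_. 0)"

definition delta :: "'a \<Rightarrow> 'a \<Rightarrow> complex" where
  "delta x y = (if y = x then 1 else 0)"

definition annihilates :: "complex poly \<Rightarrow> bool" where
  "annihilates p \<longleftrightarrow> (\<forall>x\<in>V. \<forall>y\<in>V. papp p (delta x) y = 0)"

definition eigval :: "complex \<Rightarrow> bool" where
  "eigval \<theta> \<longleftrightarrow> (\<exists>f. (\<exists>x\<in>V. f x \<noteq> 0) \<and> (\<forall>x\<in>V. app f x = \<theta> * f x))"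

lemma app_zero [simp]: "app (\<lambda>_. 0) = (\<lambda>_. 0)"
  by (simp add: app_def fun_eq_iff)

lemma app_add: "app (\<lambda>x. f x + g x) = (\<lambda>x. app f x + app g x)"
  by (simp add: app_def fun_eq_iff sum.distrib ring_distribs)

lemma app_cmult: "app (\<lambda>x. c * f x) = (\<lambda>x. c * app f x)"
  by (simp add: app_def fun_eq_iff sum_distrib_left mult.left_commute)

lemma app_cong: "(\<And>x. x \<in> V \<Longrightarrow> f x = g x) \<Longrightarrow> app f = app g"
  by (simp add: app_def fun_eq_iff)

lemma papp_0 [simp]: "papp 0 f = (\<lambda>_. 0)"
  by (simp add: papp_def)

lemma papp_pCons [simp]: "papp (pCons a p) f = (\<lambda>x. a * f x + app (papp p f) x)"
  by (cases "p = 0 \<and> a = 0") (auto simp: papp_def)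

lemma papp_add: "papp (p + q) f = (\<lambda>x. papp p f x + papp q f x)"
  by (induction p q rule: poly_induct2) (simp_all add: app_add distrib_right add_ac)

lemma papp_smult: "papp (smult c p) f = (\<lambda>x. c * papp p f x)"
  by (induction p) (simp_all add: app_cmult distrib_left mult.assoc)

lemma papp_diff: "papp (p - q) f = (\<lambda>x. papp p f x - papp q f x)"
  using papp_add[of p "smult (-1) q" f] papp_smult[of "-1" q f] by simp

lemma papp_sum: "papp (sum p I) f = (\<lambda>x. \<Sum>i\<in>I. papp (p i) f x)"
  by (induction I rule: infinite_finite_induct) (simp_all add: papp_add)

lemma papp_mult: "papp (p * q) f = papp p (papp q f)"
  by (induction p) (simp_all add: papp_add papp_smult)

lemma papp_cong:
  assumes "\<And>x. x \<in> V \<Longrightarrow> f x = g x" "x \<in> V"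
  shows "papp p f x = papp p g x"
proof -
  have "\<forall>x\<in>V. papp p f x = papp p g x"
  proof (induction p)
    case (pCons a p)
    then have "app (papp p f) = app (papp p g)" by (intro app_cong) auto
    then show ?case using assms by simp
  qed simp
  then show ?thesis using assms by blast
qed

lemma papp_eigen:
  assumes "\<And>x. x \<in> V \<Longrightarrow> app f x = \<theta> * f x" "x \<in> V"
  shows "papp p f x = poly p \<theta> * f x"
proof -
  have "\<forall>x\<in>V. papp p f x = poly p \<theta> * f x"
  proof (induction p)
    case (pCons a p)
    then have "app (papp p f) = app (\<lambda>x. poly p \<theta> * f x)" by (intro app_cong) auto
    then show ?case using assms by (simp add: app_cmult) (simp add: algebra_simps)
  qed simp
  then show ?thesis using assms by blast
qed

section \<open>Symmetry and entries of p(A)\<close>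

lemma app_adjoint: "(\<Sum>x\<in>V. f x * app g x) = (\<Sum>x\<in>V. app f x * g x)"
proof -
  have "(\<Sum>x\<in>V. f x * app g x) = (\<Sum>x\<in>V. \<Sum>y\<in>V. f x * A x y * g y)"
    by (simp add: app_def sum_distrib_left mult.assoc)
  also have "\<dots> = (\<Sum>y\<in>V. \<Sum>x\<in>V. f x * A x y * g y)"
    by (rule sum.swap)
  also have "\<dots> = (\<Sum>y\<in>V. (\<Sum>x\<in>V. A y x * f x) * g y)"
    by (subst sym) (simp add: sum_distrib_left mult.left_commute mult.commute)
  also have "\<dots> = (\<Sum>x\<in>V. app f x * g x)"
    by (simp add: app_def)
  finally show ?thesis .
qed

lemma papp_adjoint: "(\<Sum>x\<in>V. f x * papp p g x) = (\<Sum>x\<in>V. papp p f x * g x)"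
proof (induction p arbitrary: g)
  case (pCons a p)
  \<comment> \<open>A commutes with p(A) because p commutes with the monomial X.\<close>
  have comm: "papp p (app g) = app (papp p g)"
    using papp_mult[of p "[:0, 1:]" g] papp_mult[of "[:0, 1:]" p g] by (simp add: mult.commute)
  have "(\<Sum>x\<in>V. f x * papp (pCons a p) g x) =
      a * (\<Sum>x\<in>V. f x * g x) + (\<Sum>x\<in>V. f x * papp p (app g) x)"
    by (simp add: comm sum.distrib ring_distribs sum_distrib_left mult.left_commute)
  also have "\<dots> = a * (\<Sum>x\<in>V. f x * g x) + (\<Sum>x\<in>V. app (papp p f) x * g x)"
    by (simp add: pCons.IH app_adjoint)
  also have "\<dots> = (\<Sum>x\<in>V. papp (pCons a p) f x * g x)"
    by (simp add: sum.distrib ring_distribs sum_distrib_left mult.assoc)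
  finally show ?case .
qed simp

lemma sum_delta:
  assumes "x \<in> V"
  shows "(\<Sum>z\<in>V. delta x z * f z) = f x" "(\<Sum>z\<in>V. f z * delta x z) = f x"
proof -
  show "(\<Sum>z\<in>V. delta x z * f z) = f x"
    using assms finite_V by (simp add: delta_def if_distrib[of "\<lambda>c. c * _"] cong: if_cong)
  then show "(\<Sum>z\<in>V. f z * delta x z) = f x"
    by (simp add: mult.commute)
qed

text \<open>Moving p(A) onto \<open>delta x\<close> expands p(A) f by rows, so the values on the
  \<open>delta x\<close> determine p(A) on \<open>V\<close>.\<close>

lemma papp_eq_sum_delta:
  assumes "x \<in> V"
  shows "papp p f x = (\<Sum>z\<in>V. papp p (delta x) z * f z)"
  unfolding papp_adjoint[symmetric] sum_delta(1)[OF assms] ..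

lemma papp_delta_sym:
  assumes "x \<in> V" "y \<in> V"
  shows "papp p (delta x) y = papp p (delta y) x"
  unfolding papp_eq_sum_delta[OF assms(1), of p "delta y"] sum_delta(2)[OF assms(2)] ..

section \<open>Annihilating polynomials and eigenvalues\<close>

lemma annihilatesD:
  assumes "annihilates p" "x \<in> V"
  shows "papp p f x = 0"
  unfolding papp_eq_sum_delta[OF assms(2)] using assms by (simp add: annihilates_def)

lemma annihilates_eigval:
  assumes "annihilates p" "eigval \<theta>"
  shows "poly p \<theta> = 0"
proof -
  obtain f x where "x \<in> V" "f x \<noteq> 0" "\<forall>x\<in>V. app f x = \<theta> * f x"
    using assms(2) by (auto simp: eigval_def)
  then show ?thesis
    using papp_eigen[of f \<theta> x p] annihilatesD[OF assms(1), of x f] by simp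
qed

lemma app_cnj: "app (\<lambda>x. cnj (f x)) = (\<lambda>x. cnj (app f x))"
  by (simp add: app_def fun_eq_iff real)

text \<open>Positive definiteness of the Hermitian form: the sum consists of the squared moduli of
  \<open>w\<close>.\<close>

lemma sum_cnj_zeroD:
  assumes "(\<Sum>x\<in>V. w x * cnj (w x)) = 0" "x \<in> V"
  shows "w x = 0"
proof -
  have "(\<Sum>x\<in>V. complex_of_real ((cmod (w x))\<^sup>2)) = 0"
    using assms(1) by (simp only: complex_norm_square)
  then have "(\<Sum>x\<in>V. (cmod (w x))\<^sup>2) = 0"
    by (metis of_real_eq_0_iff of_real_sum)
  then show ?thesis
    using sum_nonneg_eq_0_iff[OF finite_V, of "\<lambda>x. (cmod (w x))\<^sup>2"] assms(2) by simp
qed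

lemma eigval_real:
  assumes "eigval \<theta>"
  shows "cnj \<theta> = \<theta>"
proof -
  obtain f x where f: "x \<in> V" "f x \<noteq> 0" "\<forall>x\<in>V. app f x = \<theta> * f x"
    using assms by (auto simp: eigval_def)
  have "cnj \<theta> * (\<Sum>x\<in>V. f x * cnj (f x)) = (\<Sum>x\<in>V. f x * app (\<lambda>x. cnj (f x)) x)"
    using f by (simp add: app_cnj sum_distrib_left mult.left_commute)
  also have "\<dots> = (\<Sum>x\<in>V. app f x * cnj (f x))"
    by (rule app_adjoint)
  also have "\<dots> = \<theta> * (\<Sum>x\<in>V. f x * cnj (f x))"
    using f by (simp add: sum_distrib_left mult.assoc)
  finally show ?thesis
    using sum_cnj_zeroD[of f x] f by auto
qed

text \<open>Any finite family of linear functionals on polynomials has common zeros of arbitrarily large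
  degree: combine two zeros of the first functionals to kill the next one.\<close>

lemma papp_common_zero:
  assumes "finite I"
  shows "\<exists>p. N < degree p \<and> (\<forall>(x, y)\<in>I. papp p (delta x) y = 0)"
  using assms
proof (induction I arbitrary: N rule: finite_induct)
  case empty
  have "degree (monom (1::complex) (Suc N)) = Suc N" by (simp add: degree_monom_eq)
  then show ?case by (metis empty_iff lessI)
next
  case (insert i I)
  obtain x y where i: "i = (x, y)" by (cases i)
  obtain p where p: "N < degree p" "\<forall>(x, y)\<in>I. papp p (delta x) y = 0"
    using insert.IH by blast
  \<comment> \<open>With the degree of \<open>q\<close> above that of \<open>p\<close>, subtracting
    a multiple of \<open>p\<close> keeps the degree of \<open>q\<close>.\<close>
  obtain q where q: "degree p < degree q" "\<forall>(x, y)\<in>I. papp q (delta x) y = 0"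
    using insert.IH by blast
  show ?case
  proof (cases "papp p (delta x) y = 0")
    case True
    then show ?thesis using p i by auto
  next
    case False
    define c where "c = papp q (delta x) y / papp p (delta x) y"
    let ?s = "q - smult c p"
    have "degree (smult c p) < degree q"
      using q(1) degree_smult_le[of c p] by linarith
    then have "degree ?s = degree q"
      by (metis degree_add_eq_left degree_minus diff_conv_add_uminus)
    moreover have "papp ?s (delta x) y = 0"
      using False by (simp add: papp_diff papp_smult c_def)
    moreover have "\<forall>(x, y)\<in>I. papp ?s (delta x) y = 0"
      using p(2) q(2) by (fastforce simp: papp_diff papp_smult)
    ultimately show ?thesis
      using p(1) q(1) i by (intro exI[of _ ?s]) auto
  qed
qed

lemma ex_annihilates: "\<exists>p. p \<noteq> 0 \<and> annihilates p"
proof -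
  obtain p where "0 < degree p" "\<forall>(x, y)\<in>V \<times> V. papp p (delta x) y = 0"
    using papp_common_zero[of "V \<times> V" 0] finite_V by auto
  then show ?thesis by (intro exI[of _ p]) (auto simp: annihilates_def)
qed

text \<open>A nonzero annihilating polynomial of minimal degree has only eigenvalues as roots, and
  each of them is simple because the kernel is Hermitian.\<close>

lemma ex_annihilates_degree: "\<exists>m. annihilates m \<and> degree m = card {\<theta>. eigval \<theta>}"
proof -
  obtain m where m: "m \<noteq> 0" "annihilates m"
    and min: "\<And>p. p \<noteq> 0 \<Longrightarrow> annihilates p \<Longrightarrow> degree m \<le> degree p"
    using ex_has_least_nat[of "\<lambda>p. p \<noteq> 0 \<and> annihilates p" _ degree] ex_annihilates by blast
  \<comment> \<open>By minimality no cofactor of a linear factor of \<open>m\<close>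
    annihilates.\<close>
  have not_ann: "\<not> annihilates q" if "m = [:-a, 1:] * q" for a q
  proof
    have q0: "q \<noteq> 0" using that m by auto
    assume "annihilates q"
    then have "degree m \<le> degree q" using min q0 by blast
    moreover have "degree m = Suc (degree q)"
      unfolding that using q0 by (subst degree_mult_eq) auto
    ultimately show False by simp
  qed
  have roots: "eigval a" if "poly m a = 0" for a
  proof -
    obtain q where q: "m = [:-a, 1:] * q"
      using \<open>poly m a = 0\<close> unfolding poly_eq_0_iff_dvd by (rule dvdE)
    \<comment> \<open>A nonzero column of q(A) is killed by A - a, hence is an eigenvector.\<close>
    then obtain x y where xy: "x \<in> V" "y \<in> V" "papp q (delta x) y \<noteq> 0"
      using not_ann[OF q] by (auto simp: annihilates_def)
    have "papp [:-a, 1:] (papp q (delta x)) z = 0" if "z \<in> V" for z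
      using annihilatesD[OF m(2) that] by (simp only: q papp_mult)
    then show ?thesis
      unfolding eigval_def using xy by (intro exI[of _ "papp q (delta x)"]) auto
  qed
  have simple: "\<not> [:-a, 1:] * [:-a, 1:] dvd m" for a
  proof
    assume "[:-a, 1:] * [:-a, 1:] dvd m"
    then obtain q where q: "m = [:-a, 1:] * ([:-a, 1:] * q)"
      by (metis dvdE mult.assoc)
    then have "poly m a = 0" by simp
    then have a: "cnj a = a" by (intro eigval_real roots)
    have "papp ([:-a, 1:] * q) (delta x) y = 0" if "x \<in> V" "y \<in> V" for x y
    proof -
      define g where "g = papp q (delta x)"
      define w where "w = papp [:-a, 1:] g"
      \<comment> \<open>As \<open>a\<close> is real, A - a commutes with conjugation. With w = (A -
        a) g this turns the squared norm of \<open>w\<close> into the pairing of (A - a) w = 0 with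
        the conjugate of \<open>g\<close>. So (A - a) q(A) already vanishes, against
        minimality.\<close>
      have cnj_w: "(\<lambda>z. cnj (w z)) = papp [:-a, 1:] (\<lambda>z. cnj (g z))"
        by (simp add: w_def app_cnj a)
      have "papp [:-a, 1:] w z = 0" if "z \<in> V" for z
        using annihilatesD[OF m(2) that, of "delta x"] by (simp only: q papp_mult w_def g_def)
      then have "(\<Sum>z\<in>V. papp [:-a, 1:] w z * cnj (g z)) = 0"
        by (simp del: papp_pCons)
      then have "(\<Sum>z\<in>V. w z * cnj (w z)) = 0"
        unfolding papp_adjoint[symmetric] cnj_w[symmetric] .
      then have "w y = 0" by (rule sum_cnj_zeroD) fact
      then show ?thesis by (simp only: w_def g_def papp_mult)
    qed
    then show False using not_ann[OF q] by (simp add: annihilates_def)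
  qed
  have eq: "{z. poly m z = 0} = {\<theta>. eigval \<theta>}"
    using roots annihilates_eigval[OF m(2)] by blast
  show ?thesis
    using card_roots_eq_degree[OF m(1) simple] m(2) eq by auto
qed

end

subsection \<open>Non-backtracking walks\<close>

text \<open>A walk starting at \<open>x\<close> is the list of its steps (edge, new vertex), last step first.\<close>

fun walk_end :: "'a \<Rightarrow> ('a set \<times> 'a) list \<Rightarrow> 'a" where
  "walk_end x [] = x"
| "walk_end x ((e, y) # w) = y"

text \<open>Consecutive edges must differ, which rules out moving on inside an edge as well as
  turning back.\<close>

fun nb_walk :: "'a set set \<Rightarrow> 'a \<Rightarrow> ('a set \<times> 'a) list \<Rightarrow> bool" where
  "nb_walk E x [] \<longleftrightarrow> True"
| "nb_walk E x ((e, y) # w) \<longleftrightarrow>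
     nb_walk E x w \<and> e \<in> E \<and> walk_end x w \<in> e \<and> y \<in> e \<and> y \<noteq> walk_end x w \<and>
     (w = [] \<or> fst (hd w) \<noteq> e)"

lemma walk_end_append: "walk_end x (a @ b) = walk_end (walk_end x b) a"
  by (cases "(x, a)" rule: walk_end.cases) auto

lemma walk_end_eq_hd: "w \<noteq> [] \<Longrightarrow> walk_end x w = snd (hd w)"
  by (cases "(x, w)" rule: walk_end.cases) auto

lemma nb_walk_append: "nb_walk E x (a @ b) \<Longrightarrow> nb_walk E x b \<and> nb_walk E (walk_end x b) a"
  by (induction a) (auto simp: walk_end_append)

text \<open>The steps are stored last first, so the resulting walk is the reversed one, ending in
  \<open>x\<close>.\<close>

lemma hyper_walk_if_nb_walk:
  assumes "hypergraph V E" "nb_walk E x w" "x \<in> V"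
  shows "hyper_walk V E (map snd w @ [x]) (map fst w)"
  using assms(2)
proof (induction w)
  case Nil
  then show ?case using assms by (simp add: hyper_walk_def)
next
  case (Cons s w)
  obtain e y where s: "s = (e, y)" by (cases s)
  have "e \<subseteq> V" using Cons.prems s assms(1) by (auto simp: hypergraph_def)
  moreover have "(map snd w @ [x]) ! 0 = walk_end x w"
    by (cases "(x, w)" rule: walk_end.cases) auto
  ultimately show ?case
    using Cons s by (auto simp: hyper_walk_def All_less_Suc2)
qed

lemma not_distinct_map_decomp:
  assumes "\<not> distinct (map f w)"
  obtains a s b t c where "w = a @ (s # b) @ t # c" "f s = f t"
proof -
  have "\<exists>a s b t c. w = a @ (s # b) @ t # c \<and> f s = f t"
    using assms
  proof (induction w)
    case (Cons s w)
    show ?case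
    proof (cases "f s \<in> f ` set w")
      case True
      then obtain t where "t \<in> set w" "f s = f t" by auto
      moreover from this obtain b c where "w = b @ t # c" by (meson split_list)
      ultimately show ?thesis by (intro exI[of _ "[]"]) auto
    next
      case False
      then obtain a s' b t c where "w = a @ (s' # b) @ t # c" "f s' = f t"
        using Cons by auto
      then show ?thesis by (intro exI[of _ "s # a"]) auto
    qed
  qed simp
  then show ?thesis using that by blast
qed

text \<open>A shortest closed non-backtracking walk is a Berge cycle: a repeated vertex splits off a
  shorter closed walk, and so does a repeated edge, after a detour inside that edge.\<close>

lemma nb_walk_closed_ge_girth:
  assumes "hypergraph V E" "nb_walk E x w" "walk_end x w = x" "w \<noteq> []"
  shows "hyper_girth V E \<le> enat (length w)"
  using assms(2-)
proof (induction "length w" arbitrary: x w rule: less_induct)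
  case less
  have IH: "hyper_girth V E \<le> enat (length w)"
    if "nb_walk E z c" "walk_end z c = z" "c \<noteq> []" "length c < length w" for z c
    using less.hyps[of c z] that by (meson enat_ord_simps(1) less_imp_le order_trans)
  consider (vertices) "\<not> distinct (map snd w)" | (edges) "\<not> distinct (map fst w)"
    | (distinct) "distinct (map snd w)" "distinct (map fst w)" by blast
  then show ?case
  proof cases
    case vertices
    then obtain a b c e f v where w: "w = a @ ((e, v) # b) @ (f, v) # c"
      by (elim not_distinct_map_decomp) (metis prod.collapse)
    have "nb_walk E v ((e, v) # b)"
      using less.prems(1) nb_walk_append[of E x "a @ (e, v) # b" "(f, v) # c"]
        nb_walk_append[of E v a "(e, v) # b"] unfolding w by simp
    then show ?thesis by (rule IH) (simp_all add: w)
  next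
    case edges
    then obtain a b c e v v' where w: "w = a @ ((e, v) # b) @ (e, v') # c"
      by (elim not_distinct_map_decomp) (metis prod.collapse)
    have nb: "nb_walk E x (((e, v) # b) @ (e, v') # c)"
      using less.prems(1) nb_walk_append[of E x a "((e, v) # b) @ (e, v') # c"] unfolding w by simp
    then have nb': "nb_walk E v' ((e, v) # b)" and b: "b \<noteq> []" and "v' \<in> e"
      using nb_walk_append[of E x "(e, v) # b" "(e, v') # c"]
        nb_walk_append[of E x "b" "(e, v') # c"] by auto
    show ?thesis
    proof (cases "walk_end v' b = v'")
      case True
      then show ?thesis using nb' b by (intro IH[of v' b]) (simp_all add: w)
    next
      case False
      \<comment> \<open>\<open>b\<close> leads from \<open>v'\<close> to another vertex of
        \<open>e\<close>, and a step inside \<open>e\<close> back to \<open>v'\<close> closes it.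
        This omits one of the two uses of \<open>e\<close> in \<open>w\<close>.\<close>
      then have "nb_walk E v' ((e, v') # b)" using nb' \<open>v' \<in> e\<close> by auto
      then show ?thesis by (rule IH) (simp_all add: w)
    qed
  next
    case distinct
    have "x \<in> V"
      using less.prems assms(1) by (cases "(x, w)" rule: walk_end.cases) (auto simp: hypergraph_def)
    then have "berge_cycle V E (map snd w @ [x]) (map fst w)"
      using hyper_walk_if_nb_walk[OF assms(1) less.prems(1)] distinct less.prems
      by (simp add: berge_cycle_def butlast_append hd_append hd_map walk_end_eq_hd)
    then show ?thesis
      unfolding hyper_girth_def by (intro INF_lower2) auto
  qed
qed

text \<open>Follow \<open>p\<close>, then \<open>q\<close> backwards. The steps of \<open>q\<close>
  are moved onto \<open>p\<close> one at a time, and the last hypothesis excludes backtracking at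
  the junction.\<close>

lemma nb_walk_join:
  assumes "nb_walk E x q" "nb_walk E z p" "walk_end z p = walk_end x q"
    "p = [] \<or> q = [] \<or> fst (hd p) \<noteq> fst (hd q)"
  shows "\<exists>c. nb_walk E z c \<and> walk_end z c = x \<and> length c = length p + length q"
  using assms
proof (induction q arbitrary: p)
  case Nil
  then show ?case by auto
next
  case (Cons s q)
  obtain e y where s: "s = (e, y)" by (cases s)
  have "\<exists>c. nb_walk E z c \<and> walk_end z c = x \<and>
      length c = length ((e, walk_end x q) # p) + length q"
    using Cons.prems s by (intro Cons.IH) auto
  then show ?case by simp
qed

text \<open>Two distinct non-backtracking walks with the same ends close up after removing their common
  final part; if they enter their common end vertex through the same edge from different
  vertices, one step is saved inside that edge.\<close>

lemma nb_walk_unique: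
  assumes "hypergraph V E" "nb_walk E x p" "nb_walk E x q" "walk_end x p = walk_end x q" "p \<noteq> q"
  shows "hyper_girth V E \<le> enat (length p + length q)"
  using assms(2-)
proof (induction "length p + length q" arbitrary: p q rule: less_induct)
  case less
  have IH: "hyper_girth V E \<le> enat (length p + length q)"
    if "nb_walk E x a" "nb_walk E x b" "walk_end x a = walk_end x b" "a \<noteq> b"
      "length a + length b < length p + length q" for a b
    using less.hyps[of a b] that by (meson enat_ord_simps(1) less_imp_le order_trans)
  show ?case
  proof (cases "p = [] \<or> q = [] \<or> fst (hd p) \<noteq> fst (hd q)")
    case True
    then obtain c where "nb_walk E x c" "walk_end x c = x" "length c = length p + length q"
      using nb_walk_join[OF less.prems(2,1,3)] by blast
    moreover from this have "c \<noteq> []" using less.prems(4) by auto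
    ultimately show ?thesis using nb_walk_closed_ge_girth[OF assms(1), of x c] by simp
  next
    case False
    then obtain e y p' q' where p: "p = (e, y) # p'" and q: "q = (e, y) # q'"
      using less.prems(3) by (cases p; cases q) auto
    show ?thesis
    proof (cases "walk_end x p' = walk_end x q'")
      case True
      then show ?thesis using less.prems by (intro IH[of p' q']) (auto simp: p q)
    next
      case False
      \<comment> \<open>The walk on the right ends with \<open>e\<close>, while \<open>p'\<close> is
        empty or ends with another edge, since \<open>p\<close> continues it through
        \<open>e\<close>.\<close>
      have "p' \<noteq> (e, walk_end x p') # q'"
        using less.prems(1) unfolding p by (metis fst_conv list.distinct(1) list.sel(1) nb_walk.simps(2))
      then show ?thesis
        using False less.prems by (intro IH[of p' "(e, walk_end x p') # q'"]) (auto simp: p q)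
    qed
  qed
qed


subsection \<open>Distances\<close>

definition collinear :: "'a set set \<Rightarrow> ('a \<times> 'a) set" where
  "collinear E = {(x, y). \<exists>e\<in>E. x \<in> e \<and> y \<in> e \<and> x \<noteq> y}"

text \<open>The least exponent is meaningful only for pairs joined by a walk; connectedness provides
  this later.\<close>

definition hdist :: "'a set set \<Rightarrow> 'a \<Rightarrow> 'a \<Rightarrow> nat" where
  "hdist E x y = (LEAST n. (x, y) \<in> collinear E ^^ n)"

lemma sym_collinear: "sym (collinear E)"
  by (auto simp: sym_def collinear_def)

lemma hdist_le: "(x, y) \<in> collinear E ^^ n \<Longrightarrow> hdist E x y \<le> n"
  unfolding hdist_def by (rule Least_le)

lemma nb_walk_relpow: "nb_walk E x w \<Longrightarrow> (x, walk_end x w) \<in> collinear E ^^ length w"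
proof (induction w)
  case (Cons s w)
  obtain e y where s: "s = (e, y)" by (cases s)
  have "(walk_end x w, y) \<in> collinear E" using Cons.prems s by (auto simp: collinear_def)
  then show ?case using Cons s by (auto intro: relpow_Suc_I)
qed simp

text \<open>Two consecutive steps through one edge could be replaced by at most one, so a shortest
  walk never backtracks.\<close>

lemma geodesic_nb_walk:
  assumes "(x, y) \<in> collinear E ^^ n" "hdist E x y = n"
  shows "\<exists>w. nb_walk E x w \<and> walk_end x w = y \<and> length w = n"
  using assms
proof (induction n arbitrary: y)
  case 0
  then show ?case by (intro exI[of _ "[]"]) simp
next
  case (Suc n)
  obtain z where z: "(x, z) \<in> collinear E ^^ n" "(z, y) \<in> collinear E"
    using Suc.prems by (meson relpow_Suc_E)
  obtain e where e: "e \<in> E" "z \<in> e" "y \<in> e" "z \<noteq> y"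
    using z(2) by (auto simp: collinear_def)
  have "(x, y) \<in> collinear E ^^ Suc (hdist E x z)"
    using z by (intro relpow_Suc_I[of _ z]) (auto simp: hdist_def intro: LeastI)
  then have "n \<le> hdist E x z" using hdist_le Suc.prems(2) by fastforce
  then have "hdist E x z = n" using hdist_le[OF z(1)] by simp
  then obtain w where w: "nb_walk E x w" "walk_end x w = z" "length w = n"
    using Suc.IH z(1) by blast
  have "fst (hd w) \<noteq> e" if nonempty: "w \<noteq> []"
  proof
    assume "fst (hd w) = e"
    then obtain w' where w': "w = (e, z) # w'"
      using nonempty w(2) \<open>fst (hd w) = e\<close> by (cases w) auto
    have "(walk_end x w', y) \<in> collinear E \<or> walk_end x w' = y"
      using w(1) e by (auto simp: w' collinear_def)
    moreover have "(x, walk_end x w') \<in> collinear E ^^ length w'"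
      using w(1) w' nb_walk_relpow[of E x w'] by simp
    ultimately have "hdist E x y \<le> Suc (length w')"
      by (metis hdist_le le_SucI relpow_Suc_I)
    then show False using Suc.prems(2) w(3) w' by simp
  qed
  then have "nb_walk E x ((e, y) # w)" using w e by auto
  then show ?case using w by (intro exI[of _ "(e, y) # w"]) simp
qed

lemma relpow_sym: "sym R \<Longrightarrow> (x, y) \<in> R ^^ n \<Longrightarrow> (y, x) \<in> R ^^ n"
proof (induction n arbitrary: y)
  case (Suc n)
  then obtain z where "(x, z) \<in> R ^^ n" "(z, y) \<in> R" by (meson relpow_Suc_E)
  then show ?case using Suc by (meson relpow_Suc_I2 symE)
qed auto

lemma hdist_commute: "hdist E x y = hdist E y x"
proof -
  have "(x, y) \<in> collinear E ^^ n \<longleftrightarrow> (y, x) \<in> collinear E ^^ n" for n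
    by (meson relpow_sym sym_collinear)
  then show ?thesis by (simp add: hdist_def)
qed

lemma hyper_walk_relpow:
  assumes "hyper_walk V E xs es"
  shows "(hd xs, last xs) \<in> collinear E ^^ length es"
proof -
  have "\<forall>i<length es. (xs ! i, xs ! Suc i) \<in> collinear E"
    using assms by (auto simp: hyper_walk_def collinear_def intro: nth_mem)
  moreover have "xs \<noteq> []" using assms by (auto simp: hyper_walk_def)
  then have "xs ! 0 = hd xs" "xs ! length es = last xs"
    using assms hd_conv_nth[of xs] last_conv_nth[of xs] by (auto simp: hyper_walk_def)
  ultimately show ?thesis
    unfolding relpow_fun_conv by (intro exI[of _ "(!) xs"]) simp
qed

subsection \<open>Intersection numbers inside the girth\<close>

locale large_girth_hypergraph =
  fixes V :: "'a set" and E :: "'a set set" and r u d :: nat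
  assumes hyp: "hypergraph V E"
    and conn: "hyper_connected V E"
    and reg: "hyper_regular V E r"
    and unif: "hyper_uniform E u"
    and girth: "enat (2 * d - 1) \<le> hyper_girth V E"
    and d2: "2 \<le> d"
begin

definition nbrs :: "'a \<Rightarrow> 'a set" where
  "nbrs y = {z. (y, z) \<in> collinear E}"

lemma finite_V: "finite V"
  using hyp by (simp add: hypergraph_def)

lemma finite_E: "finite E"
  using hyp by (meson Pow_iff finite_Pow_iff finite_subset hypergraph_def subsetI)

lemma edge_subset: "e \<in> E \<Longrightarrow> e \<subseteq> V"
  using hyp by (simp add: hypergraph_def)

lemma finite_edge: "e \<in> E \<Longrightarrow> finite e"
  using edge_subset finite_V finite_subset by blast

lemma card_edge: "e \<in> E \<Longrightarrow> card e = u"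
  using unif by (simp add: hyper_uniform_def)

lemma nbrs_subset: "nbrs y \<subseteq> V"
  using edge_subset by (auto simp: nbrs_def collinear_def)

lemma finite_nbrs: "finite (nbrs y)"
  using nbrs_subset finite_V finite_subset by blast

text \<open>The total length stays below the girth bound \<open>2 * d - 1\<close>; in particular
  this covers two walks of length at most \<open>d - 1\<close>.\<close>

lemma nb_walk_eq:
  assumes "nb_walk E x p" "nb_walk E x q" "walk_end x p = walk_end x q"
    "length p + length q \<le> 2 * d - 2"
  shows "p = q"
proof (rule ccontr)
  assume "p \<noteq> q"
  then have "enat (2 * d - 1) \<le> enat (length p + length q)"
    using nb_walk_unique[OF hyp assms(1-3)] girth by (meson order_trans)
  then show False using assms(4) d2 by simp
qed

text \<open>Two edges through \<open>y\<close> and \<open>z\<close> are two one-step walks, of total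
  length 2, which is at most \<open>2 * d - 2\<close>.\<close>

lemma edge_unique:
  assumes "e \<in> E" "f \<in> E" "y \<in> e" "y \<in> f" "z \<in> e" "z \<in> f" "y \<noteq> z"
  shows "e = f"
  using nb_walk_eq[of y "[(e, z)]" "[(f, z)]"] assms d2 by auto

lemma hyper_adj_eq: "hyper_adj E y z = (if z \<in> nbrs y then 1 else 0)"
proof (cases "z \<in> nbrs y")
  case True
  then obtain e where e: "e \<in> E" "y \<in> e" "z \<in> e" "y \<noteq> z"
    by (auto simp: nbrs_def collinear_def)
  then have "{e \<in> E. {y, z} \<subseteq> e} = {e}" using edge_unique by auto
  then show ?thesis using True e(4) by (simp add: hyper_adj_def)
next
  case False
  then have "y = z \<or> {e \<in> E. {y, z} \<subseteq> e} = {}" by (auto simp: nbrs_def collinear_def)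
  then show ?thesis using False unfolding hyper_adj_def by (metis card.empty)
qed

lemma card_nbrs:
  assumes "y \<in> V"
  shows "card (nbrs y) = r * (u - 1)"
proof -
  have disj: "\<forall>e\<in>{e\<in>E. y \<in> e}. \<forall>f\<in>{e\<in>E. y \<in> e}. e \<noteq> f \<longrightarrow> (e - {y}) \<inter> (f - {y}) = {}"
    using edge_unique by blast
  have "nbrs y = (\<Union>e\<in>{e\<in>E. y \<in> e}. e - {y})"
    by (auto simp: nbrs_def collinear_def)
  also have "card \<dots> = (\<Sum>e\<in>{e\<in>E. y \<in> e}. card (e - {y}))"
    using finite_E finite_edge by (intro card_UN_disjoint disj) auto
  also have "\<dots> = (\<Sum>e\<in>{e\<in>E. y \<in> e}. u - 1)"
    using card_edge finite_edge by (intro sum.cong) auto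
  finally show ?thesis using reg assms by (simp add: hyper_regular_def)
qed

lemma relpow_hdist:
  assumes "x \<in> V" "y \<in> V"
  shows "(x, y) \<in> collinear E ^^ hdist E x y"
proof -
  obtain xs es where "hyper_walk V E xs es" "hd xs = x" "last xs = y"
    using conn assms unfolding hyper_connected_def by blast
  then have "(x, y) \<in> collinear E ^^ length es" using hyper_walk_relpow by blast
  then show ?thesis unfolding hdist_def by (rule LeastI)
qed

lemma geodesic:
  assumes "x \<in> V" "y \<in> V"
  obtains w where "nb_walk E x w" "walk_end x w = y" "length w = hdist E x y"
  using geodesic_nb_walk[OF relpow_hdist[OF assms] refl] by blast

lemma hdist_nbrs_le:
  assumes "x \<in> V" "y \<in> V" "z \<in> nbrs y"
  shows "hdist E x z \<le> Suc (hdist E x y)"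
  using relpow_hdist[OF assms(1,2)] assms(3) unfolding nbrs_def
  by (intro hdist_le relpow_Suc_I) auto

lemma nbrs_sym: "z \<in> nbrs y \<longleftrightarrow> y \<in> nbrs z"
  by (auto simp: nbrs_def collinear_def)

lemma walk_end_in_V: "x \<in> V \<Longrightarrow> nb_walk E x w \<Longrightarrow> walk_end x w \<in> V"
  using edge_subset by (cases "(x, w)" rule: walk_end.cases) auto

section \<open>Distance classes among the neighbours of a vertex\<close>

text \<open>A geodesic to the same end is no longer than \<open>w\<close>, so uniqueness makes it
  equal to \<open>w\<close>.\<close>

lemma hdist_nb_walk:
  assumes "x \<in> V" "nb_walk E x w" "length w \<le> d - 1"
  shows "hdist E x (walk_end x w) = length w"
proof -
  obtain p where p: "nb_walk E x p" "walk_end x p = walk_end x w"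
    "length p = hdist E x (walk_end x w)"
    using geodesic[OF assms(1) walk_end_in_V[OF assms(1,2)]] by blast
  then have "length p \<le> length w"
    using nb_walk_relpow[OF assms(2)] by (simp add: hdist_le)
  then have "p = w" using p(1,2) assms by (intro nb_walk_eq) auto
  then show ?thesis using p(3) by simp
qed

text \<open>A geodesic to such a \<open>z\<close> extends to \<open>y\<close> without backtracking,
  since \<open>y\<close> is farther away; by uniqueness the extension is the given walk. This gives
  c_n = 1.\<close>

lemma nbrs_hdist_pred:
  assumes "x \<in> V" "nb_walk E x ((e, y) # w)" "length w < d - 1"
  shows "{z \<in> nbrs y. hdist E x z = length w} = {walk_end x w}"
proof (intro equalityI subsetI)
  fix z assume "z \<in> {z \<in> nbrs y. hdist E x z = length w}"
  then have z: "z \<in> nbrs y" "hdist E x z = length w" by auto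
  have y: "hdist E x y = Suc (length w)"
    using hdist_nb_walk[OF assms(1,2)] assms(3) by simp
  have "z \<in> V" using z nbrs_subset by blast
  then obtain p where p: "nb_walk E x p" "walk_end x p = z" "length p = length w"
    using geodesic[OF assms(1)] z(2) by metis
  obtain f where f: "f \<in> E" "y \<in> f" "z \<in> f" "y \<noteq> z"
    using z by (auto simp: nbrs_def collinear_def)
  have "fst (hd p) \<noteq> f" if "p \<noteq> []"
  proof
    assume "fst (hd p) = f"
    then obtain p' where p': "p = (f, z) # p'"
      using p(2) \<open>p \<noteq> []\<close> by (cases p) auto
    have "y \<noteq> walk_end x p'"
    proof
      assume "y = walk_end x p'"
      then have "hdist E x y \<le> length p'"
        using nb_walk_relpow[of E x p'] p(1) by (simp add: p' hdist_le)
      then show False using y p(3) p' by simp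
    qed
    then have "nb_walk E x ((f, y) # p')" using p(1) f by (auto simp: p')
    then have "hdist E x y \<le> length p"
      using nb_walk_relpow[of E x "(f, y) # p'"] by (simp add: hdist_le p')
    then show False using y p(3) by simp
  qed
  then have "nb_walk E x ((f, y) # p)" using p f by auto
  then have "(f, y) # p = (e, y) # w"
    using assms p(3) by (intro nb_walk_eq) auto
  then show "z \<in> {walk_end x w}" using p(2) by simp
next
  fix z assume "z \<in> {walk_end x w}"
  then show "z \<in> {z \<in> nbrs y. hdist E x z = length w}"
    using assms hdist_nb_walk[OF assms(1), of w] by (auto simp: nbrs_def collinear_def)
qed

text \<open>Leaving \<open>y\<close> through another edge goes one farther; the other vertices of
  \<open>e\<close> are reached by changing the last step. The bound lets the extended walk, of
  length \<open>length w + 2\<close>, still be a geodesic. This gives a_n = u - 2.\<close>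

lemma nbrs_hdist_same:
  assumes "x \<in> V" "nb_walk E x ((e, y) # w)" "Suc (length w) < d - 1"
  shows "{z \<in> nbrs y. hdist E x z = Suc (length w)} = e - {y, walk_end x w}"
proof (intro equalityI subsetI)
  fix z assume "z \<in> {z \<in> nbrs y. hdist E x z = Suc (length w)}"
  then have z: "z \<in> nbrs y" "hdist E x z = Suc (length w)" by auto
  obtain f where f: "f \<in> E" "y \<in> f" "z \<in> f" "y \<noteq> z"
    using z by (auto simp: nbrs_def collinear_def)
  have "f = e"
  proof (rule ccontr)
    assume "f \<noteq> e"
    then have "nb_walk E x ((f, z) # (e, y) # w)" using assms(2) f by auto
    from hdist_nb_walk[OF assms(1) this] show False using assms(3) z(2) by simp
  qed
  moreover have "z \<noteq> walk_end x w"
    using hdist_nb_walk[OF assms(1), of w] assms z(2) by auto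
  ultimately show "z \<in> e - {y, walk_end x w}" using f by auto
next
  fix z assume z: "z \<in> e - {y, walk_end x w}"
  then have "nb_walk E x ((e, z) # w)" using assms(2) by auto
  from hdist_nb_walk[OF assms(1) this] have "hdist E x z = Suc (length w)"
    using assms(3) by simp
  then show "z \<in> {z \<in> nbrs y. hdist E x z = Suc (length w)}"
    using z assms(2) by (auto simp: nbrs_def collinear_def)
qed

lemma card_nbrs_hdist_pred:
  assumes "x \<in> V" "y \<in> V" "hdist E x y = Suc n" "Suc n \<le> d - 1"
  shows "card {z \<in> nbrs y. hdist E x z = n} = 1"
proof -
  obtain p where p: "nb_walk E x p" "walk_end x p = y" "length p = Suc n"
    using geodesic[OF assms(1,2)] assms(3) by metis
  then obtain e w where "p = (e, y) # w" "length w = n"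
    by (cases "(x, p)" rule: walk_end.cases) auto
  then show ?thesis
    using nbrs_hdist_pred[of x e y w] p assms by simp
qed

lemma card_nbrs_hdist_same:
  assumes "x \<in> V" "y \<in> V" "hdist E x y = n" "1 \<le> n" "n < d - 1"
  shows "card {z \<in> nbrs y. hdist E x z = n} = u - 2"
proof -
  obtain p where p: "nb_walk E x p" "walk_end x p = y" "length p = n"
    using geodesic[OF assms(1,2)] assms(3) by metis
  then obtain e w where w: "p = (e, y) # w" "n = Suc (length w)"
    using assms(4) by (cases "(x, p)" rule: walk_end.cases) auto
  then have "{z \<in> nbrs y. hdist E x z = n} = e - {y, walk_end x w}"
    using nbrs_hdist_same[of x e y w] p assms by simp
  then show ?thesis
    using p w card_edge finite_edge by (auto simp: card_Diff_subset)
qed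

text \<open>The neighbours of \<open>y\<close> lie at distance n - 1, n or n + 1 from
  \<open>x\<close>, so the last class is what the valency leaves over.\<close>

lemma card_nbrs_hdist_succ:
  assumes "x \<in> V" "y \<in> V" "hdist E x y = n" "1 \<le> n" "n < d - 1"
  shows "card {z \<in> nbrs y. hdist E x z = Suc n} + (u - 2) + 1 = r * (u - 1)"
proof -
  let ?C = "\<lambda>k. {z \<in> nbrs y. hdist E x z = k}"
  have "hdist E x z \<in> {Suc n, n, n - 1}" if "z \<in> nbrs y" for z
    using hdist_nbrs_le[OF assms(1,2) that] hdist_nbrs_le[OF assms(1), of z y] that
      nbrs_sym nbrs_subset assms(3) by fastforce
  then have "nbrs y = ?C (Suc n) \<union> ?C n \<union> ?C (n - 1)" by auto
  then have "card (nbrs y) = card (?C (Suc n) \<union> ?C n \<union> ?C (n - 1))" by simp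
  also have "\<dots> = card (?C (Suc n)) + card (?C n) + card (?C (n - 1))"
    using finite_nbrs assms(4) by (subst card_Un_disjoint; (subst card_Un_disjoint)?) auto
  finally show ?thesis
    using card_nbrs[OF assms(2)] card_nbrs_hdist_same[OF assms]
      card_nbrs_hdist_pred[OF assms(1,2), of "n - 1"] assms by simp
qed

lemma hdist_eq_0_iff: "x \<in> V \<Longrightarrow> y \<in> V \<Longrightarrow> hdist E x y = 0 \<longleftrightarrow> x = y"
  using relpow_hdist[of x y] hdist_le[of x x 0 E] by auto

lemma hdist_eq_1_iff:
  assumes "x \<in> V" "y \<in> V"
  shows "hdist E x y = 1 \<longleftrightarrow> x \<in> nbrs y"
proof
  assume "hdist E x y = 1"
  then have "(x, y) \<in> collinear E" using relpow_hdist[OF assms] by simp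
  then show "x \<in> nbrs y" by (auto simp: nbrs_def collinear_def)
next
  assume *: "x \<in> nbrs y"
  then have "hdist E x y \<le> 1" by (intro hdist_le) (auto simp: nbrs_def collinear_def)
  moreover have "hdist E x y \<noteq> 0"
    using * hdist_eq_0_iff[OF assms] by (auto simp: nbrs_def collinear_def)
  ultimately show "hdist E x y = 1" by simp
qed

text \<open>The numbers \<open>b\<^sub>n\<close> of the intersection array.\<close>

definition b :: "nat \<Rightarrow> complex" where
  "b n = of_nat (r * (u - 1)) - (if n = 0 then 0 else of_nat (u - 2) + 1)"

text \<open>Entry form of the recurrence A A_n = A_(n+1) + (u - 2) A_n + b_(n-1) A_(n-1) for the
  distance matrices.\<close>

lemma card_nbrs_hdist:
  assumes "x \<in> V" "y \<in> V" "1 \<le> n" "Suc n \<le> d - 1"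
  shows "complex_of_nat (card {z \<in> nbrs y. hdist E x z = n}) =
    of_bool (hdist E x y = Suc n) + of_nat (u - 2) * of_bool (hdist E x y = n) +
    b (n - 1) * of_bool (hdist E x y = n - 1)"
proof -
  consider "hdist E x y = Suc n" | "hdist E x y = n" | "hdist E x y = n - 1" "n = 1"
    | "hdist E x y = n - 1" "n > 1"
    | "hdist E x y > Suc n \<or> hdist E x y < n - 1" by linarith
  then show ?thesis
  proof cases
    case 1
    then have "hdist E x y \<noteq> n - 1" by simp
    then show ?thesis using 1 card_nbrs_hdist_pred[OF assms(1,2)] assms by simp
  next
    case 2
    have "n \<noteq> n - 1" using assms(3) by simp
    then show ?thesis using 2 card_nbrs_hdist_same[OF assms(1,2)] assms by simp
  next
    case 3
    then have "y = x" using relpow_hdist[OF assms(1,2)] by simp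
    have "hdist E x z = 1" if "z \<in> nbrs x" for z
      using that hdist_eq_1_iff[OF assms(1), of z] nbrs_sym nbrs_subset by blast
    then have "{z \<in> nbrs y. hdist E x z = n} = nbrs x" using \<open>y = x\<close> 3(2) by auto
    then show ?thesis using card_nbrs[OF assms(1)] 3 by (simp add: b_def)
  next
    case 4
    have "complex_of_nat (card {z \<in> nbrs y. hdist E x z = n} + (u - 2) + 1) = of_nat (r * (u - 1))"
      using card_nbrs_hdist_succ[OF assms(1,2) 4(1)] 4 assms by simp
    moreover have "n - 1 \<noteq> Suc n" "n - 1 \<noteq> n" "n - 1 \<noteq> 0" using 4(2) by auto
    ultimately show ?thesis using 4(1) by (simp add: b_def algebra_simps)
  next
    case 5
    have "hdist E x z \<noteq> n" if "z \<in> nbrs y" for z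
      using hdist_nbrs_le[OF assms(1,2) that] hdist_nbrs_le[OF assms(1), of z y] that
        nbrs_sym nbrs_subset 5 by fastforce
    then have "{z \<in> nbrs y. hdist E x z = n} = {}" by auto
    then show ?thesis using 5 assms(3) by (simp only: card.empty) auto
  qed
qed

end

subsection \<open>Distance polynomials\<close>

context large_girth_hypergraph
begin

sublocale sym_kernel V "\<lambda>x y. of_nat (hyper_adj E x y)"
  using finite_V by unfold_locales (simp_all add: hyper_adj_def insert_commute)

lemma app_eq_sum_nbrs: "app f x = (\<Sum>y\<in>nbrs x. f y)"
proof -
  have "app f x = (\<Sum>y\<in>V. if y \<in> nbrs x then f y else 0)"
    unfolding app_def by (intro sum.cong) (simp_all add: hyper_adj_eq)
  also have "\<dots> = (\<Sum>y\<in>nbrs x. f y)"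
    using finite_V nbrs_subset by (simp add: sum.If_cases Int_absorb1)
  finally show ?thesis .
qed

lemma ex_distance_poly:
  assumes "n \<le> d - 1"
  shows "\<exists>p. p \<noteq> 0 \<and> degree p = n \<and>
    (\<forall>x\<in>V. \<forall>y\<in>V. papp p (delta x) y = of_bool (hdist E x y = n))"
  using assms
proof (induction n rule: less_induct)
  case (less n)
  consider "n = 0" | "n = 1" | m where "n = Suc m" "1 \<le> m"
    by (metis One_nat_def Suc_le_eq not0_implies_Suc zero_less_Suc neq0_conv)
  then show ?case
  proof cases
    case 1
    then show ?thesis by (intro exI[of _ "[:1:]"]) (auto simp: delta_def hdist_eq_0_iff)
  next
    case 2
    have "app (delta x) y = of_bool (x \<in> nbrs y)" for x y
      using finite_nbrs by (simp add: app_eq_sum_nbrs delta_def)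
    then show ?thesis
      using 2 hdist_eq_1_iff by (intro exI[of _ "[:0, 1:]"]) (simp add: fun_eq_iff)
  next
    case 3
    obtain p where p: "p \<noteq> 0" "degree p = m"
      "\<And>x y. x \<in> V \<Longrightarrow> y \<in> V \<Longrightarrow> papp p (delta x) y = of_bool (hdist E x y = m)"
      using less.IH[of m] 3 less.prems by auto
    have less_m: "m - 1 < n" "m - 1 \<le> d - 1" using 3 less.prems by auto
    obtain q where q: "degree q = m - 1"
      "\<And>x y. x \<in> V \<Longrightarrow> y \<in> V \<Longrightarrow> papp q (delta x) y = of_bool (hdist E x y = m - 1)"
      using less.IH[OF less_m] by blast
    \<comment> \<open>The recurrence solved for its top term gives X p - s. Since \<open>s\<close>
      has degree at most \<open>m\<close>, the product of X and \<open>p\<close> determines the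
      degree.\<close>
    define s where "s = smult (of_nat (u - 2)) p + smult (b (m - 1)) q"
    have "degree s \<le> m"
      unfolding s_def using p(2) q(1) by (intro degree_add_le order.trans[OF degree_smult_le]) auto
    then have "degree (pCons 0 p - s) = n"
      using p 3 degree_add_eq_left[of "- s" "pCons 0 p"] by simp
    moreover from this have "pCons 0 p - s \<noteq> 0" using 3 by auto
    moreover have "papp (pCons 0 p - s) (delta x) y = of_bool (hdist E x y = n)"
      if "x \<in> V" "y \<in> V" for x y
    proof -
      have "app (papp p (delta x)) y = (\<Sum>z\<in>nbrs y. of_bool (hdist E x z = m))"
        unfolding app_eq_sum_nbrs by (intro sum.cong refl p(3)) (use that nbrs_subset in auto)
      also have "\<dots> = of_nat (card {z \<in> nbrs y. hdist E x z = m})"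
        using finite_nbrs by (simp add: Int_def)
      finally show ?thesis
        using card_nbrs_hdist[OF that 3(2)] 3(1) less.prems p(3) q(2) that
        by (simp add: papp_diff papp_add papp_smult s_def)
    qed
    ultimately show ?thesis by blast
  qed
qed

text \<open>Maximum principle: at a vertex where \<open>h\<close> is maximal, all neighbours take
  the same value, and connectedness spreads it over \<open>V\<close>.\<close>

lemma harmonic_const_real:
  fixes h :: "'a \<Rightarrow> real"
  assumes "\<And>x. x \<in> V \<Longrightarrow> (\<Sum>y\<in>nbrs x. h y) = real (r * (u - 1)) * h x" "x \<in> V" "y \<in> V"
  shows "h x = h y"
proof -
  have fin: "finite (h ` V)" "h ` V \<noteq> {}" using finite_V assms(2) by auto
  obtain x0 where x0: "x0 \<in> V" "h x0 = Max (h ` V)" using Max_in[OF fin] by auto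
  then have max: "h z \<le> h x0" if "z \<in> V" for z using fin(1) that by simp
  have "z \<in> V \<and> h z = h x0" if "(x0, z) \<in> collinear E ^^ n" for n z
    using that
  proof (induction n arbitrary: z)
    case 0
    then show ?case using x0 by simp
  next
    case (Suc n)
    obtain w where "(x0, w) \<in> collinear E ^^ n" and z: "z \<in> nbrs w"
      using Suc.prems by (auto simp: nbrs_def elim: relpow_Suc_E)
    then have w: "w \<in> V" "h w = h x0" using Suc.IH by auto
    have "(\<Sum>y\<in>nbrs w. h w - h y) = 0"
      using assms(1)[OF w(1)] card_nbrs[OF w(1)] by (simp add: sum_subtractf)
    moreover have "0 \<le> h w - h y" if "y \<in> nbrs w" for y
      using max[of y] w(2) that nbrs_subset by auto
    ultimately have "\<forall>y\<in>nbrs w. h w - h y = 0"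
      using sum_nonneg_eq_0_iff[OF finite_nbrs, of w "\<lambda>y. h w - h y"] by blast
    then show ?case using z w nbrs_subset by auto
  qed
  then have "h z = h x0" if "z \<in> V" for z
    using relpow_hdist[OF x0(1) that] by blast
  then show ?thesis using assms(2,3) by simp
qed

lemma harmonic_const:
  assumes "\<And>x. x \<in> V \<Longrightarrow> app f x = of_nat (r * (u - 1)) * f x" "x \<in> V" "y \<in> V"
  shows "f x = f y"
proof -
  define k where "k = real (r * (u - 1))"
  have eq: "(\<Sum>y\<in>nbrs x. f y) = of_real k * f x" if "x \<in> V" for x
    using assms(1)[OF that] by (simp add: app_eq_sum_nbrs k_def)
  have Re: "(\<Sum>y\<in>nbrs x. Re (f y)) = k * Re (f x)" if "x \<in> V" for x
    using arg_cong[OF eq[OF that], of Re] by simp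
  have Im: "(\<Sum>y\<in>nbrs x. Im (f y)) = k * Im (f x)" if "x \<in> V" for x
    using arg_cong[OF eq[OF that], of Im] by simp
  show ?thesis
    using harmonic_const_real[OF Re[unfolded k_def] assms(2,3)]
      harmonic_const_real[OF Im[unfolded k_def] assms(2,3)] by (rule complex_eqI)
qed

text \<open>Each factor A reaches only one step farther, so a polynomial of degree k has no entries
  beyond distance k.\<close>

lemma papp_delta_eq_0_if_hdist_gt:
  assumes "x \<in> V" "y \<in> V" "degree p < hdist E x y"
  shows "papp p (delta x) y = 0"
  using assms(2,3)
proof (induction p arbitrary: y)
  case (pCons a p)
  have "x \<noteq> y" using pCons.prems assms(1) hdist_eq_0_iff by fastforce
  moreover have "papp p (delta x) z = 0" if z: "z \<in> nbrs y" for z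
  proof (cases "p = 0")
    case False
    have "hdist E x y \<le> Suc (hdist E x z)"
      using z nbrs_sym nbrs_subset assms(1) by (intro hdist_nbrs_le) auto
    then show ?thesis using pCons z nbrs_subset False by (intro pCons.IH) auto
  qed simp
  then have "app (papp p (delta x)) y = 0"
    unfolding app_eq_sum_nbrs by (intro sum.neutral) blast
  moreover have "delta x y = 0" using \<open>x \<noteq> y\<close> by (simp add: delta_def)
  ultimately show ?case by simp
qed simp

end

subsection \<open>The extremal case\<close>

locale extremal_hypergraph = large_girth_hypergraph +
  assumes card_eigenvalues: "card (hyper_eigenvalues V E) = d + 1"
begin

lemma card_eigvals: "card {\<theta>. eigval \<theta>} = d + 1"
proof -
  obtain vs where vs: "distinct vs" "set vs = V"
    using finite_distinct_list[OF finite_V] by blast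
  then have "hyper_eigenvalues V E = {\<theta>. eigval \<theta>}"
    unfolding eigval_def app_def hyper_eigenvalues_eq_spectrum[OF vs] spectrum_def
      eigenvalue_hyper_adj_mat_iff[OF vs] by simp
  then show ?thesis using card_eigenvalues by simp
qed

text \<open>An empty vertex set has no eigenvectors, but there are \<open>d + 1\<close>
  eigenvalues.\<close>

lemma V_nonempty: "V \<noteq> {}"
  using card_eigvals by (auto simp: eigval_def)

lemma app_const: "x \<in> V \<Longrightarrow> app (\<lambda>_. 1) x = of_nat (r * (u - 1))"
  by (simp add: app_eq_sum_nbrs card_nbrs)

lemma annihilates_degree_ge:
  assumes "p \<noteq> 0" "annihilates p"
  shows "d + 1 \<le> degree p"
proof -
  have "card {\<theta>. eigval \<theta>} \<le> card {z. poly p z = 0}"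
    using annihilates_eigval[OF assms(2)] poly_roots_finite[OF assms(1)] by (intro card_mono) auto
  also have "\<dots> \<le> degree p"
    using assms(1) by (rule card_poly_roots_bound)
  finally show ?thesis using card_eigvals by simp
qed

text \<open>The quotient of the minimal polynomial by its factor at the valency is a multiple of the
  Hoffman polynomial.\<close>

lemma ex_hoffman_poly:
  "\<exists>h c. degree h = d \<and> c \<noteq> 0 \<and> (\<forall>x\<in>V. \<forall>y\<in>V. papp h (delta x) y = c)"
proof -
  let ?k = "of_nat (r * (u - 1)) :: complex"
  obtain m where m: "annihilates m" "degree m = d + 1"
    using ex_annihilates_degree card_eigvals by auto
  have "eigval ?k"
    unfolding eigval_def using V_nonempty app_const by (intro exI[of _ "\<lambda>_. 1"]) auto
  then have "poly m ?k = 0" by (rule annihilates_eigval[OF m(1)])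
  then obtain h where h: "m = [:- ?k, 1:] * h"
    unfolding poly_eq_0_iff_dvd by (rule dvdE)
  have h0: "h \<noteq> 0" using h m(2) by auto
  have "degree m = Suc (degree h)"
    unfolding h using h0 by (subst degree_mult_eq) auto
  then have deg: "degree h = d" using m(2) by simp
  \<comment> \<open>The columns of h(A) are killed by A minus the valency, hence constant.\<close>
  have eq: "papp h (delta x) y = papp h (delta x) z" if "x \<in> V" "y \<in> V" "z \<in> V" for x y z
  proof (rule harmonic_const)
    fix z assume "z \<in> V"
    have "papp [:- ?k, 1:] (papp h (delta x)) z = 0"
      using annihilatesD[OF m(1) \<open>z \<in> V\<close>, of "delta x"] by (simp only: h papp_mult)
    then show "app (papp h (delta x)) z = ?k * papp h (delta x) z" by simp
  qed (use that in auto)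
  obtain x0 where x0: "x0 \<in> V" using V_nonempty by blast
  define c where "c = papp h (delta x0) x0"
  \<comment> \<open>Symmetry of h(A) makes the constants of all columns agree.\<close>
  have const: "papp h (delta x) y = c" if "x \<in> V" "y \<in> V" for x y
    using eq[OF that x0] papp_delta_sym[OF that(1) x0] eq[OF x0 that(1) x0] by (simp add: c_def)
  moreover have "c \<noteq> 0"
  proof
    assume "c = 0"
    then have "annihilates h" using const by (simp add: annihilates_def)
    then show False using annihilates_degree_ge[OF h0] deg by simp
  qed
  ultimately show ?thesis using deg by blast
qed

section \<open>The diameter and the last distance matrix\<close>

text \<open>h(A) has degree \<open>d\<close> and no zero entry, whereas its entries beyond distance
  \<open>d\<close> would vanish.\<close>

lemma hdist_le_d:
  assumes "x \<in> V" "y \<in> V"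
  shows "hdist E x y \<le> d"
proof (rule ccontr)
  obtain h c where h: "degree h = d" "c \<noteq> 0" "\<forall>x\<in>V. \<forall>y\<in>V. papp h (delta x) y = c"
    using ex_hoffman_poly by blast
  assume "\<not> hdist E x y \<le> d"
  then show False using h papp_delta_eq_0_if_hdist_gt[OF assms, of h] assms by simp
qed

lemma ex_ball_poly:
  "\<exists>q. degree q \<le> d - 1 \<and>
    (\<forall>x\<in>V. \<forall>y\<in>V. papp q (delta x) y = of_bool (hdist E x y < d))"
proof -
  have "\<forall>n\<in>{..<d}. \<exists>p. p \<noteq> 0 \<and> degree p = n \<and>
    (\<forall>x\<in>V. \<forall>y\<in>V. papp p (delta x) y = of_bool (hdist E x y = n))"
  proof
    fix n assume "n \<in> {..<d}"
    then have "n \<le> d - 1" by auto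
    then show "\<exists>p. p \<noteq> 0 \<and> degree p = n \<and>
      (\<forall>x\<in>V. \<forall>y\<in>V. papp p (delta x) y = of_bool (hdist E x y = n))"
      by (rule ex_distance_poly)
  qed
  from bchoice[OF this] obtain P where P: "\<forall>n\<in>{..<d}. P n \<noteq> 0 \<and> degree (P n) = n \<and>
    (\<forall>x\<in>V. \<forall>y\<in>V. papp (P n) (delta x) y = of_bool (hdist E x y = n))" ..
  have "papp (\<Sum>n<d. P n) (delta x) y = of_bool (hdist E x y < d)" if "x \<in> V" "y \<in> V" for x y
  proof -
    have "papp (\<Sum>n<d. P n) (delta x) y = (\<Sum>n<d. if hdist E x y = n then 1 else 0)"
      unfolding papp_sum using P that by (intro sum.cong) auto
    then show ?thesis by simp
  qed
  moreover have "degree (\<Sum>n<d. P n) \<le> d - 1"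
    using P by (intro degree_sum_le) auto
  ultimately show ?thesis by blast
qed

text \<open>Otherwise the ball polynomial \<open>q\<close> gives the all-ones matrix, and
  multiplying by X minus the valency yields a nonzero annihilating polynomial of degree at most
  \<open>d\<close>.\<close>

lemma ex_hdist_eq_d: "\<exists>x\<in>V. \<exists>y\<in>V. hdist E x y = d"
proof (rule ccontr)
  let ?k = "of_nat (r * (u - 1)) :: complex"
  assume *: "\<not> ?thesis"
  have lt: "hdist E x y < d" if "x \<in> V" "y \<in> V" for x y
    using hdist_le_d[OF that] * that by (meson le_neq_implies_less)
  obtain q where q: "degree q \<le> d - 1"
      "\<forall>x\<in>V. \<forall>y\<in>V. papp q (delta x) y = of_bool (hdist E x y < d)"
    using ex_ball_poly by blast
  have 1: "papp q (delta x) y = 1" if "x \<in> V" "y \<in> V" for x y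
    using q(2) lt that by simp
  have "papp ([:- ?k, 1:] * q) (delta x) y = 0" if "x \<in> V" "y \<in> V" for x y
  proof -
    have "papp ([:- ?k, 1:] * q) (delta x) y = papp [:- ?k, 1:] (\<lambda>_. 1) y"
      unfolding papp_mult using 1 that by (intro papp_cong) auto
    then show ?thesis using app_const[OF that(2)] by simp
  qed
  then have "annihilates ([:- ?k, 1:] * q)" unfolding annihilates_def by blast
  moreover have q0: "q \<noteq> 0" using 1 V_nonempty by fastforce
  moreover have "[:- ?k, 1:] * q \<noteq> 0" by (intro no_zero_divisors q0) simp
  ultimately have "d + 1 \<le> degree ([:- ?k, 1:] * q)" using annihilates_degree_ge by blast
  moreover have "degree ([:- ?k, 1:] * q) = Suc (degree q)"
    using q0 by (subst degree_mult_eq) auto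
  ultimately show False using q(1) d2 by linarith
qed

lemma ex_distance_poly_le:
  assumes "n \<le> d"
  shows "\<exists>p. \<forall>x\<in>V. \<forall>y\<in>V. papp p (delta x) y = of_bool (hdist E x y = n)"
proof (cases "n = d")
  case False
  then have "n \<le> d - 1" using assms by simp
  then show ?thesis using ex_distance_poly by blast
next
  case True
  obtain q where q: "\<forall>x\<in>V. \<forall>y\<in>V. papp q (delta x) y = of_bool (hdist E x y < d)"
    using ex_ball_poly by blast
  obtain h c where h: "c \<noteq> 0" "\<forall>x\<in>V. \<forall>y\<in>V. papp h (delta x) y = c"
    using ex_hoffman_poly by blast
  \<comment> \<open>The all-ones matrix minus the pairs at distance below \<open>d\<close> leaves
    exactly the pairs at distance \<open>d\<close>.\<close>
  have "papp (smult (1 / c) h - q) (delta x) y = of_bool (hdist E x y = n)"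
    if "x \<in> V" "y \<in> V" for x y
    using h q that hdist_le_d[OF that] True by (auto simp: papp_diff papp_smult)
  then show ?thesis by blast
qed

section \<open>Polynomials in A as combinations of the distance matrices\<close>

definition constant_on_distances :: "complex poly \<Rightarrow> bool" where
  "constant_on_distances p \<longleftrightarrow> (\<exists>c. \<forall>x\<in>V. \<forall>y\<in>V. papp p (delta x) y = c (hdist E x y))"

text \<open>One witness in each degree: a distance polynomial below \<open>d\<close>, the Hoffman
  multiple at \<open>d\<close>, and above it a multiple of the annihilating polynomial, whose
  entries are all 0.\<close>

lemma ex_constant_on_distances: "\<exists>p. p \<noteq> 0 \<and> degree p = n \<and> constant_on_distances p"
proof -
  obtain m where m: "annihilates m" "degree m = d + 1"
    using ex_annihilates_degree card_eigvals by auto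
  obtain h c where h: "degree h = d" "\<forall>x\<in>V. \<forall>y\<in>V. papp h (delta x) y = c"
    using ex_hoffman_poly by blast
  consider "n < d" | "n = d" | "n \<ge> d + 1" by linarith
  then show ?thesis
  proof cases
    case 1
    then have "n \<le> d - 1" by simp
    then obtain p where "p \<noteq> 0" "degree p = n"
      "\<forall>x\<in>V. \<forall>y\<in>V. papp p (delta x) y = of_bool (hdist E x y = n)"
      using ex_distance_poly[of n] by blast
    then show ?thesis
      unfolding constant_on_distances_def
      by (intro exI[of _ p]) (auto intro!: exI[of _ "\<lambda>l. of_bool (l = n)"])
  next
    case 2
    then show ?thesis
      using h d2 unfolding constant_on_distances_def
      by (intro exI[of _ h]) (auto intro!: exI[of _ "\<lambda>_. c"])
  next
    case 3
    let ?q = "m * monom 1 (n - (d + 1))"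
    have "m \<noteq> 0" using m(2) by auto
    then have "?q \<noteq> 0" "degree ?q = n"
      using 3 m(2) by (simp_all add: degree_mult_eq degree_monom_eq monom_eq_0_iff)
    moreover have "constant_on_distances ?q"
      unfolding constant_on_distances_def papp_mult using annihilatesD[OF m(1)]
      by (intro exI[of _ "\<lambda>_. 0"]) simp
    ultimately show ?thesis by blast
  qed
qed

text \<open>Subtracting a multiple of the witness of equal degree removes the leading term, and
  induction on the degree does the rest.\<close>

lemma constant_on_distances: "constant_on_distances p"
proof (induction "degree p" arbitrary: p rule: less_induct)
  case less
  obtain q where q: "q \<noteq> 0" "degree q = degree p" "constant_on_distances q"
    using ex_constant_on_distances by blast
  define a where "a = lead_coeff p / lead_coeff q"
  let ?s = "p - smult a q"
  have "coeff ?s (degree p) = 0" using q(2) leading_coeff_neq_0[OF q(1)] by (simp add: a_def)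
  moreover have "degree ?s \<le> degree p"
    using q(2) by (intro degree_diff_le) (auto intro: order.trans[OF degree_smult_le])
  ultimately have "?s = 0 \<or> degree ?s < degree p"
    using eq_zero_or_degree_less by blast
  moreover have "constant_on_distances 0"
    unfolding constant_on_distances_def by (intro exI[of _ "\<lambda>_. 0"]) simp
  ultimately have "constant_on_distances ?s" using less by auto
  then obtain c c' where "\<forall>x\<in>V. \<forall>y\<in>V. papp ?s (delta x) y = c (hdist E x y)"
    "\<forall>x\<in>V. \<forall>y\<in>V. papp q (delta x) y = c' (hdist E x y)"
    using q(3) unfolding constant_on_distances_def by blast
  then show ?case
    unfolding constant_on_distances_def
    by (intro exI[of _ "\<lambda>l. c l + a * c' l"]) (auto simp: papp_diff papp_smult algebra_simps)
qed

text \<open>The number counted is the (x, y) entry of A_i A_j, a polynomial in A, hence a function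
  of the distance alone.\<close>

lemma card_hdist_hdist:
  "\<exists>n. \<forall>x\<in>V. \<forall>y\<in>V. hdist E x y = l \<longrightarrow> card {z \<in> V. hdist E x z = i \<and> hdist E z y = j} = n"
proof (cases "i \<le> d \<and> j \<le> d")
  case True
  then obtain p where p: "\<forall>x\<in>V. \<forall>y\<in>V. papp p (delta x) y = of_bool (hdist E x y = i)"
    using ex_distance_poly_le[of i] by auto
  obtain q where q: "\<forall>x\<in>V. \<forall>y\<in>V. papp q (delta x) y = of_bool (hdist E x y = j)"
    using ex_distance_poly_le[of j] True by blast
  obtain c where c: "\<forall>x\<in>V. \<forall>y\<in>V. papp (p * q) (delta x) y = c (hdist E x y)"
    using constant_on_distances[of "p * q"] unfolding constant_on_distances_def by blast
  \<comment> \<open>The floor of the real part recovers the natural number from the complex value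
    \<open>c\<close>.\<close>
  have card_eq: "card {z \<in> V. hdist E x z = i \<and> hdist E z y = j} = nat \<lfloor>Re (c (hdist E x y))\<rfloor>"
    if "x \<in> V" "y \<in> V" for x y
  proof -
    have "complex_of_nat (card {z \<in> V. hdist E x z = i \<and> hdist E z y = j}) =
        (\<Sum>z\<in>V. of_bool (hdist E x z = i \<and> hdist E z y = j))"
      using finite_V by (simp add: Int_def)
    also have "\<dots> = (\<Sum>z\<in>V. papp p (delta x) z * papp q (delta y) z)"
    proof (rule sum.cong)
      fix z assume "z \<in> V"
      then show "of_bool (hdist E x z = i \<and> hdist E z y = j) = papp p (delta x) z * papp q (delta y) z"
        using p q that by (simp add: hdist_commute[of E z y])
    qed simp
    also have "\<dots> = papp (p * q) (delta y) x"
      using papp_eq_sum_delta[OF that(1), of p "papp q (delta y)"] by (simp add: papp_mult)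
    also have "\<dots> = c (hdist E x y)" using c that by (simp add: hdist_commute[of E x y])
    finally have eq: "complex_of_nat (card {z \<in> V. hdist E x z = i \<and> hdist E z y = j}) =
      c (hdist E x y)" .
    show ?thesis unfolding eq[symmetric] by simp
  qed
  show ?thesis
  proof (intro exI ballI impI)
    fix x y assume "x \<in> V" "y \<in> V" and l: "hdist E x y = l"
    show "card {z \<in> V. hdist E x z = i \<and> hdist E z y = j} = nat \<lfloor>Re (c l)\<rfloor>"
      using card_eq[OF \<open>x \<in> V\<close> \<open>y \<in> V\<close>] unfolding l .
  qed
next
  case False
  then have "{z \<in> V. hdist E x z = i \<and> hdist E z y = j} = {}" if "x \<in> V" "y \<in> V" for x y
    using hdist_le_d that by blast
  then show ?thesis by (intro exI[of _ 0]) (simp add: card_eq_0_iff)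
qed


subsection \<open>Distances in the point graph\<close>

text \<open>Parallel arcs would come from two edges sharing two vertices.\<close>

lemma graph_point_graph: "graph (point_graph V E)"
proof -
  interpret pseudo_graph "point_graph V E"
    using pseudo_graph_point_graph[OF hyp] .
  show ?thesis
    using edge_unique by unfold_locales (auto simp: point_graph_def arc_to_ends_def)
qed

sublocale G: graph "point_graph V E"
  by (rule graph_point_graph)

lemma point_graph_simps [simp]:
  "verts (point_graph V E) = V"
  "(x, e, y) \<in> arcs (point_graph V E) \<longleftrightarrow> e \<in> E \<and> x \<in> e \<and> y \<in> e \<and> x \<noteq> y"
  "tail (point_graph V E) (x, e, y) = x"
  "head (point_graph V E) (x, e, y) = y"
  by (simp_all add: point_graph_def)

lemma relpow_if_awalk: "G.awalk x p y \<Longrightarrow> (x, y) \<in> collinear E ^^ length p"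
proof (induction p arbitrary: x)
  case Nil
  then show ?case by (simp add: G.awalk_def)
next
  case (Cons a p)
  obtain v e w where a: "a = (v, e, w)" by (cases a)
  have "(x, w) \<in> collinear E" "G.awalk w p y"
    using Cons.prems by (auto simp: G.awalk_Cons_iff a collinear_def)
  then have "(x, y) \<in> collinear E ^^ Suc (length p)" by (intro relpow_Suc_I2[OF _ Cons.IH])
  then show ?case by simp
qed

lemma awalk_if_relpow:
  assumes "(x, y) \<in> collinear E ^^ n" "x \<in> V"
  shows "\<exists>p. G.awalk x p y \<and> length p = n"
  using assms
proof (induction n arbitrary: x)
  case 0
  then show ?case by (intro exI[of _ "[]"]) (simp add: G.awalk_Nil_iff)
next
  case (Suc n)
  obtain z where z: "(x, z) \<in> collinear E" "(z, y) \<in> collinear E ^^ n"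
    using Suc.prems(1) by (meson relpow_Suc_E2)
  then obtain e where e: "e \<in> E" "x \<in> e" "z \<in> e" "x \<noteq> z" by (auto simp: collinear_def)
  then obtain p where "G.awalk z p y" "length p = n"
    using Suc.IH z(2) edge_subset by blast
  then show ?case
    using e by (intro exI[of _ "(x, e, z) # p"]) (auto simp: G.awalk_Cons_iff)
qed

lemma graph_dist_point_graph:
  assumes "x \<in> V" "y \<in> V"
  shows "graph_dist (point_graph V E) x y = ereal (hdist E x y)"
proof -
  have cost: "G.awalk_cost (\<lambda>_. 1) p = real (length p)" for p
    by (induction p) simp_all
  obtain p where p: "G.awalk x p y" "length p = hdist E x y"
    using awalk_if_relpow[OF relpow_hdist[OF assms] assms(1)] by blast
  show ?thesis
    unfolding graph_dist_def G.\<mu>_def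
  proof (rule antisym)
    show "(INF p\<in>{p. G.awalk x p y}. ereal (G.awalk_cost (\<lambda>_. 1) p)) \<le> ereal (hdist E x y)"
      using p by (intro INF_lower2[of p]) (auto simp: cost)
    show "ereal (hdist E x y) \<le> (INF p\<in>{p. G.awalk x p y}. ereal (G.awalk_cost (\<lambda>_. 1) p))"
      by (intro INF_greatest) (auto simp: cost intro: hdist_le relpow_if_awalk)
  qed
qed

lemma connected_point_graph: "Digraph_Component.connected (point_graph V E)"
proof -
  have "x \<rightarrow>\<^sup>*\<^bsub>point_graph V E\<^esub> y" if "x \<in> V" "y \<in> V" for x y
    using awalk_if_relpow[OF relpow_hdist[OF that] that(1)] by (auto simp: G.reachable_awalk)
  then show ?thesis
    using V_nonempty by (intro G.connectedI G.reachable_mk_symmetricI) auto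
qed

text \<open>In the definition of distance-regularity only \<open>l\<close> is constrained to be a natural number, so
  \<open>i\<close> and \<open>j\<close> range over the reals.\<close>

lemma distance_regular_point_graph: "distance_regular (point_graph V E)"
  unfolding distance_regular_def
proof (intro conjI allI graph_point_graph connected_point_graph)
  fix i j :: real and l :: nat
  let ?C = "\<lambda>x y. {z \<in> V. real (hdist E x z) = i \<and> real (hdist E z y) = j}"
  have "\<exists>n. \<forall>x\<in>V. \<forall>y\<in>V. hdist E x y = l \<longrightarrow> card (?C x y) = n"
  proof (cases "i \<in> \<nat> \<and> j \<in> \<nat>")
    case True
    then obtain i' j' where "i = real i'" "j = real j'" by (auto elim!: Nats_cases)
    then show ?thesis using card_hdist_hdist by simp
  next
    case False
    then have empty: "?C x y = {}" for x y by auto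
    show ?thesis unfolding empty card.empty by blast
  qed
  then obtain n where n: "\<forall>x\<in>V. \<forall>y\<in>V. hdist E x y = l \<longrightarrow> card (?C x y) = n" ..
  have "{z \<in> V. graph_dist (point_graph V E) x z = ereal i \<and>
      graph_dist (point_graph V E) z y = ereal j} = ?C x y" if "x \<in> V" "y \<in> V" for x y
    using that by (auto simp: graph_dist_point_graph)
  then show "\<exists>c. \<forall>x\<in>verts (point_graph V E). \<forall>y\<in>verts (point_graph V E).
      graph_dist (point_graph V E) x y = ereal l \<longrightarrow>
      card {z \<in> verts (point_graph V E). graph_dist (point_graph V E) x z = ereal i \<and>
        graph_dist (point_graph V E) z y = ereal j} = c"
    using n by (intro exI[of _ n]) (auto simp: graph_dist_point_graph)
qed

lemma graph_diameter_point_graph: "graph_diameter (point_graph V E) = ereal d"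
proof -
  obtain x y where "x \<in> V" "y \<in> V" "hdist E x y = d"
    using ex_hdist_eq_d by blast
  then show ?thesis
    unfolding graph_diameter_def
    by (intro antisym SUP_least; (intro SUP_upper2[of x] SUP_upper2[of y])?)
      (auto simp: graph_dist_point_graph hdist_le_d)
qed

end

theorem theorem5p1:
  fixes V :: "'a set" and E :: "'a set set" and r u d :: nat and g :: enat
  assumes "hypergraph V E"
    and "hyper_connected V E"
    and "hyper_regular V E r"
    and "hyper_uniform E u"
    and "hyper_girth V E = g"
    and "card (hyper_eigenvalues V E) = d + 1"
    and "enat (2 * d - 1) \<le> g"
    and "3 \<le> 2 * d - 1"
  shows "distance_regular (point_graph V E) \<and> graph_diameter (point_graph V E) = ereal (real d)"
proof -
  interpret extremal_hypergraph V E r u d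
    using assms by unfold_locales auto
  show ?thesis
    using distance_regular_point_graph graph_diameter_point_graph by blast
qed

end
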